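(* Let $G=(V_G,E_G)$ and $H=(V_H,E_H)$ be finite simple connected graphs with $|V_G|=n$ and $|V_H|=m$. Then $$M_1(G\wr H)=m^{n-1}\big(mM_1(G)+nM_1(H)+8|E_G||E_H|\big)$$ and $$M_2(G\wr H)=3m^{n-1}|E_H|M_1(G)+2|E_G|m^{n-1}M_1(H)+m^nM_2(G)+nm^{n-1}M_2(H)+4m^{n-2}|E_G||E_H|^2.$$
   Context: For a finite simple graph $G$, the first Zagreb index is $M_1(G)=\sum_{v\in V_G}(\deg v)^2$ and the second Zagreb index is $M_2(G)=\sum_{\{u,v\}\in E_G}\deg u\,\deg v$ (each edge counted once). The wreath product $G\wr H$ is the graph with vertex set $\{(f,v): f:V_G\to V_H,\ v\in V_G\}$, in which $(f,v)$ and $(f',v')$ are adjacent if and only if either $v=v'$, $f(w)=f'(w)$ for all $w\neq v$ and $f(v)\sim f'(v)$ in $H$; or $f=f'$ and $v\sim v'$ in $G$. *)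

theory Defs
  imports Complex_Main "HOL-Library.FuncSet" "Graph_Theory.Graph_Theory"
begin

text \<open>
  A finite simple graph is a \<^locale>\<open>pair_graph\<close>: a finite, loop-free, symmetric digraph
  without parallel arcs, in which every undirected edge \<open>{u, v}\<close> is represented by the two
  arcs \<open>(u, v)\<close> and \<open>(v, u)\<close>.
\<close>

definition uedges :: "'a pair_pre_digraph \<Rightarrow> 'a set set" where
  "uedges G = (\<lambda>(u, v). {u, v}) ` parcs G"

text \<open>By symmetry, the arcs leaving \<open>v\<close> correspond to the neighbours of \<open>v\<close>.\<close>

abbreviation deg :: "'a pair_pre_digraph \<Rightarrow> 'a \<Rightarrow> nat" where
  "deg G v \<equiv> out_degree (with_proj G) v"

definition zagreb1 :: "'a pair_pre_digraph \<Rightarrow> nat" where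
  "zagreb1 G = (\<Sum>v\<in>pverts G. (deg G v)\<^sup>2)"

text \<open>Each \<open>e = {u, v}\<close> has two distinct elements, so the inner product is \<open>deg u * deg v\<close>.\<close>

definition zagreb2 :: "'a pair_pre_digraph \<Rightarrow> nat" where
  "zagreb2 G = (\<Sum>e\<in>uedges G. \<Prod>v\<in>e. deg G v)"

text \<open>
  Functions from \<open>pverts G\<close> to \<open>pverts H\<close> are the elements of the extensional function space,
  so that each of them is counted once.
\<close>

definition wreath_product ::
  "'a pair_pre_digraph \<Rightarrow> 'b pair_pre_digraph \<Rightarrow> (('a \<Rightarrow> 'b) \<times> 'a) pair_pre_digraph" where
  "wreath_product G H =
    (let V = (pverts G \<rightarrow>\<^sub>E pverts H) \<times> pverts G in
     \<lparr> pverts = V,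
       parcs = {((f, v), (f', v')). (f, v) \<in> V \<and> (f', v') \<in> V \<and>
         (v = v' \<and> (\<forall>w\<in>pverts G. w \<noteq> v \<longrightarrow> f w = f' w) \<and> (f v, f' v) \<in> parcs H
          \<or> f = f' \<and> (v, v') \<in> parcs G)} \<rparr>)"

lemma pair_graph_wreath_product:
  assumes "pair_graph G" and "pair_graph H"
  shows "pair_graph (wreath_product G H)"
proof -
  interpret G: pair_graph G by fact
  interpret H: pair_graph H by fact
  let ?W = "wreath_product G H"
  have fin: "finite (pverts ?W)"
    by (simp add: wreath_product_def finite_PiE G.pair_finite_verts H.pair_finite_verts)
  have sub: "parcs ?W \<subseteq> pverts ?W \<times> pverts ?W"
    by (auto simp: wreath_product_def Let_def)
  have "sym (parcs G)" "sym (parcs H)"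
    using G.pair_sym_arcs H.pair_sym_arcs by (simp_all add: symmetric_def)
  then have "sym (parcs ?W)"
    by (auto simp: wreath_product_def Let_def sym_def)
  moreover have "(x, x) \<notin> parcs G" "(y, y) \<notin> parcs H" for x y
    using G.pair_no_loops[of "(x, x)"] H.pair_no_loops[of "(y, y)"] by auto
  then have "e \<in> parcs ?W \<Longrightarrow> fst e \<noteq> snd e" for e
    by (auto simp: wreath_product_def Let_def)
  moreover have "finite (parcs ?W)"
    using sub fin by (rule finite_subset[OF _ finite_cartesian_product]) (rule fin)
  ultimately show ?thesis
    using fin sub by unfold_locales (auto simp: symmetric_def)
qed

end

theory Submission
  imports Defs
begin

text \<open>
  A vertex \<open>(f, v)\<close> of the wreath product has degree \<open>deg v + deg (f v)\<close>. Summing over all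
  vertices, respectively over all arcs (which counts every edge twice), and exchanging the order
  of summation leaves sums over \<open>f\<close> of functions depending on \<open>f\<close> only through its values at one
  or two points; these contribute a factor \<open>m ^ (n - 1)\<close> or \<open>m ^ (n - 2)\<close>.
\<close>

section \<open>Sums over a function space\<close>

text \<open>Padding \<open>g (f v)\<close> with factors 1 at the other coordinates turns it into a
  product over \<open>I\<close>. Then \<open>prod_sum_PiE\<close> exchanges sum and product, and
  each padded coordinate contributes \<open>card B\<close>.\<close>

lemma sum_PiE_eval:
  fixes g :: "'b \<Rightarrow> 'c::comm_semiring_1"
  assumes "finite I" "finite B" "v \<in> I"
  shows "(\<Sum>f\<in>I \<rightarrow>\<^sub>E B. g (f v)) = of_nat (card B) ^ (card I - 1) * sum g B"
proof -
  have "(\<Sum>f\<in>I \<rightarrow>\<^sub>E B. g (f v)) = (\<Sum>f\<in>I \<rightarrow>\<^sub>E B. \<Prod>x\<in>I. if x = v then g (f x) else 1)"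
    using assms by (simp add: prod.delta)
  also have "\<dots> = (\<Prod>x\<in>I. \<Sum>y\<in>B. if x = v then g y else 1)"
    using assms by (subst prod_sum_PiE) auto
  also have "\<dots> = sum g B * (\<Prod>x\<in>I - {v}. \<Sum>y\<in>B. if x = v then g y else 1)"
    using assms by (subst prod.remove[of _ v]) auto
  also have "(\<Prod>x\<in>I - {v}. \<Sum>y\<in>B. if x = v then g y else 1) = (\<Prod>x\<in>I - {v}. of_nat (card B))"
    by (rule prod.cong) auto
  finally show ?thesis
    using assms by (simp add: mult.commute)
qed

lemma sum_PiE_eval2:
  fixes g h :: "'b \<Rightarrow> 'c::comm_semiring_1"
  assumes "finite I" "finite B" "u \<in> I" "v \<in> I" "u \<noteq> v"
  shows "(\<Sum>f\<in>I \<rightarrow>\<^sub>E B. g (f u) * h (f v)) = of_nat (card B) ^ (card I - 2) * sum g B * sum h B"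
proof -
  let ?F = "\<lambda>x y. if x = u then g y else if x = v then h y else 1"
  have "(\<Prod>x\<in>I. ?F x (f x)) = g (f u) * h (f v)" for f
    using assms by (subst prod.remove[of _ u]) (auto simp: prod.remove[of "I - {u}" v])
  then have "(\<Sum>f\<in>I \<rightarrow>\<^sub>E B. g (f u) * h (f v)) = (\<Sum>f\<in>I \<rightarrow>\<^sub>E B. \<Prod>x\<in>I. ?F x (f x))"
    by simp
  also have "\<dots> = (\<Prod>x\<in>I. \<Sum>y\<in>B. ?F x y)"
    using assms by (subst prod_sum_PiE) auto
  also have "\<dots> = sum g B * (sum h B * (\<Prod>x\<in>I - {u} - {v}. \<Sum>y\<in>B. ?F x y))"
    using assms by (subst prod.remove[of _ u], simp_all) (subst prod.remove[of _ v], auto)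
  also have "(\<Prod>x\<in>I - {u} - {v}. \<Sum>y\<in>B. ?F x y) = (\<Prod>x\<in>I - {u} - {v}. of_nat (card B))"
    by (rule prod.cong) auto
  \<comment> \<open>Since \<open>u\<close> and \<open>v\<close> are distinct elements of
    \<open>I\<close>, the subtraction does not truncate.\<close>
  also have "\<dots> = of_nat (card B) ^ (card I - 2)"
    using assms by (simp add: numeral_2_eq_2)
  finally show ?thesis
    by (simp only: mult_ac)
qed

section \<open>Neighbour sums and double counting in one graph\<close>

context pair_graph
begin

lemma finite_neighbours [simp]: "finite (parcs G `` {v})"
  using pair_finite_arcs by (rule finite_Image)

lemma neighbour_in_verts: "u \<in> parcs G `` {v} \<Longrightarrow> u \<in> pverts G"
  using in_arcsD2 by auto

lemma neighbour_neq: "u \<in> parcs G `` {v} \<Longrightarrow> u \<noteq> v"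
  using pair_no_loops[of "(v, u)"] by auto

lemma neighbour_sym: "u \<in> parcs G `` {v} \<longleftrightarrow> v \<in> parcs G `` {u}"
  using pair_sym_arcs by (auto simp: symmetric_def sym_def)

lemma deg_eq_card_neighbours: "deg G v = card (parcs G `` {v})"
proof -
  have "out_arcs (with_proj G) v = Pair v ` (parcs G `` {v})"
    by (auto simp: out_arcs_def)
  then show ?thesis
    by (simp add: out_degree_def card_image inj_on_def)
qed

lemma sum_arcs_eq_sum_neighbours:
  fixes h :: "'a \<Rightarrow> 'a \<Rightarrow> 'c::comm_monoid_add"
  shows "(\<Sum>(v, u)\<in>parcs G. h v u) = (\<Sum>v\<in>pverts G. \<Sum>u\<in>parcs G `` {v}. h v u)"
proof -
  have "parcs G = (SIGMA v:pverts G. parcs G `` {v})"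
    by (auto dest: in_arcsD1)
  then show ?thesis
    by (subst sum.Sigma) (auto simp: pair_finite_verts)
qed

text \<open>Each edge underlies exactly two arcs, one per orientation; they differ because there are
  no loops. This turns sums over edges into sums over neighbours.\<close>

lemma sum_uedges_double:
  fixes h :: "'a set \<Rightarrow> 'c::comm_semiring_1"
  shows "2 * (\<Sum>e\<in>uedges G. h e) = (\<Sum>v\<in>pverts G. \<Sum>u\<in>parcs G `` {v}. h {v, u})"
proof -
  let ?e = "\<lambda>(u, v). {u, v}"
  have "(\<Sum>v\<in>pverts G. \<Sum>u\<in>parcs G `` {v}. h {v, u}) = (\<Sum>a\<in>parcs G. h (?e a))"
    by (simp flip: sum_arcs_eq_sum_neighbours add: case_prod_beta)
  also have "\<dots> = (\<Sum>e\<in>uedges G. \<Sum>a\<in>{a\<in>parcs G. ?e a = e}. h (?e a))"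
    unfolding uedges_def by (rule sum.image_gen) (rule pair_finite_arcs)
  also have "\<dots> = (\<Sum>e\<in>uedges G. 2 * h e)"
  proof (rule sum.cong)
    fix e assume "e \<in> uedges G"
    then obtain u v where e: "e = {u, v}" and uv: "(u, v) \<in> parcs G"
      by (auto simp: uedges_def)
    then have "(v, u) \<in> parcs G" "u \<noteq> v"
      using neighbour_sym[of v u] neighbour_neq[of v u] by auto
    then have "{a\<in>parcs G. ?e a = e} = {(u, v), (v, u)}"
      using e uv by (auto simp: doubleton_eq_iff)
    then show "(\<Sum>a\<in>{a\<in>parcs G. ?e a = e}. h (?e a)) = 2 * h e"
      using e \<open>u \<noteq> v\<close> by (simp add: insert_commute mult_2)
  qed simp
  finally show ?thesis
    by (simp add: sum_distrib_left)
qed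

text \<open>The handshake lemma: double counting with constant weight 1.\<close>

lemma sum_deg: "(\<Sum>v\<in>pverts G. deg G v) = 2 * card (uedges G)"
  using sum_uedges_double[of "\<lambda>_. 1 :: nat"] by (simp add: deg_eq_card_neighbours)

text \<open>Adjacent vertices are distinct, so the product over the set \<open>{v, u}\<close> really
  has two factors.\<close>

lemma zagreb2_double:
  "2 * zagreb2 G = (\<Sum>v\<in>pverts G. \<Sum>u\<in>parcs G `` {v}. deg G v * deg G u)"
  unfolding zagreb2_def sum_uedges_double
  by (intro sum.cong refl) (simp add: neighbour_neq[symmetric] del: Image_singleton_iff)

text \<open>Adjacency is symmetric, so reversing every arc only permutes the summands.\<close>

lemma sum_neighbours_swap:
  fixes h :: "'a \<Rightarrow> 'a \<Rightarrow> 'c::comm_monoid_add"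
  shows "(\<Sum>v\<in>pverts G. \<Sum>u\<in>parcs G `` {v}. h v u)
    = (\<Sum>v\<in>pverts G. \<Sum>u\<in>parcs G `` {v}. h u v)"
proof -
  \<comment> \<open>Writing neighbourhoods as restrictions of the fixed set \<open>pverts G\<close>
    gives the shape that \<open>sum.swap_restrict\<close> exchanges.\<close>
  have N: "parcs G `` {v} = {u \<in> pverts G. u \<in> parcs G `` {v}}" for v
    using neighbour_in_verts by auto
  show ?thesis
    by (subst (1 2) N, subst sum.swap_restrict)
      (simp_all only: pair_finite_verts neighbour_sym)
qed

text \<open>The summand does not depend on \<open>u\<close>, so each vertex contributes its degree
  \<open>deg G v\<close> times.\<close>

lemma sum_neighbours_deg:
  "(\<Sum>v\<in>pverts G. \<Sum>u\<in>parcs G `` {v}. deg G v) = zagreb1 G"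
  by (simp add: zagreb1_def deg_eq_card_neighbours power2_eq_square)

lemma sum_neighbours_deg':
  "(\<Sum>v\<in>pverts G. \<Sum>u\<in>parcs G `` {v}. deg G u) = zagreb1 G"
  by (subst sum_neighbours_swap) (rule sum_neighbours_deg)

text \<open>Ensures that the exponent \<open>n - 2\<close> is not truncated whenever its term is
  nonzero.\<close>

lemma two_le_card_verts: "uedges G \<noteq> {} \<Longrightarrow> 2 \<le> card (pverts G)"
proof -
  assume "uedges G \<noteq> {}"
  then obtain u v where "(u, v) \<in> parcs G"
    by (auto simp: uedges_def)
  then have "{u, v} \<subseteq> pverts G" "u \<noteq> v"
    using neighbour_neq[of v u] by (auto dest: in_arcsD1 in_arcsD2)
  then show ?thesis
    using card_mono[of "pverts G" "{u, v}"] by (simp add: pair_finite_verts)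
qed

end

section \<open>Neighbourhoods and degrees in the wreath product\<close>

lemma verts_wreath_product:
  "pverts (wreath_product G H) = (pverts G \<rightarrow>\<^sub>E pverts H) \<times> pverts G"
  by (simp add: wreath_product_def Let_def)

locale wreath_graphs = G: pair_graph G + H: pair_graph H
  for G :: "'a pair_pre_digraph" and H :: "'b pair_pre_digraph"
begin

sublocale W: pair_graph "wreath_product G H"
  by (rule pair_graph_wreath_product) unfold_locales

text \<open>There are two kinds of move: a base move walks in \<open>G\<close> and keeps
  \<open>f\<close>, while a fibre move stays at \<open>v\<close> and walks in \<open>H\<close> with
  the value \<open>f v\<close>.\<close>

lemma neighbours_wreath_product:
  assumes f: "f \<in> pverts G \<rightarrow>\<^sub>E pverts H" and v: "v \<in> pverts G"
  shows "parcs (wreath_product G H) `` {(f, v)} =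
    Pair f ` (parcs G `` {v}) \<union> (\<lambda>y. (f(v := y), v)) ` (parcs H `` {f v})"
    (is "?L = ?R")
proof (rule antisym; rule subsetI)
  fix x assume x: "x \<in> ?L"
  obtain f' v' where [simp]: "x = (f', v')" by fastforce
  have f': "f' \<in> pverts G \<rightarrow>\<^sub>E pverts H"
    using x by (auto simp: wreath_product_def Let_def)
  consider "v' = v" "\<forall>w\<in>pverts G. w \<noteq> v \<longrightarrow> f w = f' w" "(f v, f' v) \<in> parcs H"
    | "f' = f" "(v, v') \<in> parcs G"
    using x by (auto simp: wreath_product_def Let_def)
  then show "x \<in> ?R"
  proof cases
    case 1
    \<comment> \<open>Adjacency compares the functions only on \<open>pverts G\<close>; elsewhere
      both are \<open>undefined\<close> by extensionality.\<close>
    have "f' = f(v := f' v)"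
    proof
      fix w show "f' w = (f(v := f' v)) w"
        using 1(2) PiE_arb[OF f, of w] PiE_arb[OF f', of w] by (metis fun_upd_apply)
    qed
    with 1 show ?thesis
      by (metis (no_types, lifting) UnI2 Image_singleton_iff \<open>x = (f', v')\<close> image_eqI)
  next
    case 2
    then show ?thesis by simp
  qed
next
  fix x assume "x \<in> ?R"
  then show "x \<in> ?L"
    using f v by (auto simp: wreath_product_def Let_def PiE_iff extensional_def
        dest: G.in_arcsD2 H.in_arcsD2)
qed

text \<open>Both families of moves are parametrised injectively. They are disjoint because a base
  move changes \<open>v\<close>, as \<open>G\<close> has no loops.\<close>

lemma sum_neighbours_wreath_product:
  fixes h :: "('a \<Rightarrow> 'b) \<times> 'a \<Rightarrow> 'c::comm_monoid_add"
  assumes f: "f \<in> pverts G \<rightarrow>\<^sub>E pverts H" and v: "v \<in> pverts G"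
  shows "(\<Sum>x\<in>parcs (wreath_product G H) `` {(f, v)}. h x) =
    (\<Sum>u\<in>parcs G `` {v}. h (f, u)) + (\<Sum>y\<in>parcs H `` {f v}. h (f(v := y), v))"
proof -
  have "inj_on (\<lambda>y. (f(v := y), v)) (parcs H `` {f v})"
    by (auto simp: inj_on_def dest: fun_upd_eqD)
  moreover have "inj_on (Pair f) (parcs G `` {v})"
    by (simp add: inj_on_def)
  moreover have "Pair f ` (parcs G `` {v}) \<inter> (\<lambda>y. (f(v := y), v)) ` (parcs H `` {f v}) = {}"
    using G.neighbour_neq[of v v] by auto
  ultimately show ?thesis
    unfolding neighbours_wreath_product[OF f v]
    by (subst sum.union_disjoint) (simp_all add: sum.reindex)
qed

lemma deg_wreath_product:
  assumes "f \<in> pverts G \<rightarrow>\<^sub>E pverts H" and "v \<in> pverts G"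
  shows "deg (wreath_product G H) (f, v) = deg G v + deg H (f v)"
  using sum_neighbours_wreath_product[OF assms, of "\<lambda>_. 1 :: nat"]
  by (simp add: G.deg_eq_card_neighbours H.deg_eq_card_neighbours W.deg_eq_card_neighbours)

lemma sum_PiE_verts:
  fixes g :: "'b \<Rightarrow> nat"
  assumes "v \<in> pverts G"
  shows "(\<Sum>f\<in>pverts G \<rightarrow>\<^sub>E pverts H. g (f v))
    = card (pverts H) ^ (card (pverts G) - 1) * sum g (pverts H)"
  using sum_PiE_eval[of "pverts G" "pverts H" v g] assms
  by (simp add: G.pair_finite_verts H.pair_finite_verts)

section \<open>The first Zagreb index\<close>

text \<open>The squares give the two Zagreb terms. The 8 is the 2 of the cross term times a
  handshake factor 2 from each graph.\<close>

lemma zagreb1_wreath_product: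
  defines "n \<equiv> card (pverts G)" and "m \<equiv> card (pverts H)"
  shows "zagreb1 (wreath_product G H) =
    m ^ (n - 1) * (m * zagreb1 G + n * zagreb1 H + 8 * card (uedges G) * card (uedges H))"
proof -
  have "zagreb1 (wreath_product G H)
      = (\<Sum>v\<in>pverts G. \<Sum>f\<in>pverts G \<rightarrow>\<^sub>E pverts H. (deg G v + deg H (f v))\<^sup>2)"
    unfolding zagreb1_def verts_wreath_product
    by (subst sum.swap) (simp add: sum.cartesian_product' deg_wreath_product)
  also have "\<dots> = (\<Sum>v\<in>pverts G. m ^ (n - 1) * (\<Sum>y\<in>pverts H. (deg G v + deg H y)\<^sup>2))"
    by (intro sum.cong refl)
      (simp add: sum_PiE_verts[where g = "\<lambda>y. (deg G _ + deg H y)\<^sup>2"] n_def m_def)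
  also have "\<dots> = m ^ (n - 1) * (\<Sum>v\<in>pverts G.
      m * (deg G v)\<^sup>2 + zagreb1 H + deg G v * (4 * card (uedges H)))"
  proof -
    have "(\<Sum>y\<in>pverts H. (deg G v + deg H y)\<^sup>2)
        = m * (deg G v)\<^sup>2 + zagreb1 H + 2 * deg G v * (\<Sum>y\<in>pverts H. deg H y)" for v
      by (simp add: power2_sum sum.distrib sum_distrib_left m_def zagreb1_def)
    then show ?thesis
      by (simp add: H.sum_deg sum_distrib_left mult_ac)
  qed
  also have "(\<Sum>v\<in>pverts G. m * (deg G v)\<^sup>2 + zagreb1 H + deg G v * (4 * card (uedges H)))
      = m * zagreb1 G + n * zagreb1 H + 8 * card (uedges G) * card (uedges H)"
    by (simp add: sum.distrib n_def zagreb1_def G.sum_deg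
        flip: sum_distrib_left sum_distrib_right)
  finally show ?thesis .
qed

section \<open>The second Zagreb index\<close>

text \<open>Contribution of the base moves. The product has a constant part (\<open>m ^ n\<close>),
  two parts depending on one value of \<open>f\<close> (\<open>m ^ (n - 1)\<close> each), and one
  depending on two values (\<open>m ^ (n - 2)\<close>).\<close>

lemma sum_base_arcs:
  defines "n \<equiv> card (pverts G)" and "m \<equiv> card (pverts H)"
  shows "(\<Sum>v\<in>pverts G. \<Sum>u\<in>parcs G `` {v}. \<Sum>f\<in>pverts G \<rightarrow>\<^sub>E pverts H.
      (deg G v + deg H (f v)) * (deg G u + deg H (f u)))
    = 2 * (m ^ n * zagreb2 G + 2 * m ^ (n - 1) * card (uedges H) * zagreb1 G
        + 4 * m ^ (n - 2) * card (uedges G) * (card (uedges H))\<^sup>2)"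
proof -
  let ?E = "2 * card (uedges H)"
  have inner: "(\<Sum>f\<in>pverts G \<rightarrow>\<^sub>E pverts H. (deg G v + deg H (f v)) * (deg G u + deg H (f u)))
      = m ^ n * (deg G v * deg G u) + m ^ (n - 1) * ?E * deg G v + m ^ (n - 1) * ?E * deg G u
        + m ^ (n - 2) * ?E\<^sup>2"
    if v: "v \<in> pverts G" and u: "u \<in> parcs G `` {v}" for v u
  proof -
    have u': "u \<in> pverts G" "v \<noteq> u"
      using u G.neighbour_in_verts G.neighbour_neq by auto
    \<comment> \<open>Two-point evaluation applies because \<open>v\<close> and \<open>u\<close> are
      adjacent, hence distinct.\<close>
    have "(\<Sum>f\<in>pverts G \<rightarrow>\<^sub>E pverts H. deg H (f v) * deg H (f u)) = m ^ (n - 2) * ?E\<^sup>2"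
      using sum_PiE_eval2[of "pverts G" "pverts H" v u "deg H" "deg H"] u' v
      by (simp add: G.pair_finite_verts H.pair_finite_verts H.sum_deg n_def m_def power2_eq_square)
    moreover have "card (pverts G \<rightarrow>\<^sub>E pverts H) = m ^ n"
      by (simp add: card_PiE G.pair_finite_verts n_def m_def)
    moreover have "(\<Sum>f\<in>pverts G \<rightarrow>\<^sub>E pverts H. deg H (f w)) = m ^ (n - 1) * ?E"
      if "w \<in> pverts G" for w
      using sum_PiE_verts[OF that, of "deg H"] by (simp add: H.sum_deg n_def m_def)
    ultimately show ?thesis
      using u' v by (simp add: algebra_simps sum.distrib flip: sum_distrib_left sum_distrib_right)
  qed
  have "(\<Sum>v\<in>pverts G. \<Sum>u\<in>parcs G `` {v}. \<Sum>f\<in>pverts G \<rightarrow>\<^sub>E pverts H.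
      (deg G v + deg H (f v)) * (deg G u + deg H (f u)))
    = m ^ n * (\<Sum>v\<in>pverts G. \<Sum>u\<in>parcs G `` {v}. deg G v * deg G u)
      + m ^ (n - 1) * ?E * (\<Sum>v\<in>pverts G. \<Sum>u\<in>parcs G `` {v}. deg G v)
      + m ^ (n - 1) * ?E * (\<Sum>v\<in>pverts G. \<Sum>u\<in>parcs G `` {v}. deg G u)
      + (\<Sum>v\<in>pverts G. \<Sum>u\<in>parcs G `` {v}. 1) * (m ^ (n - 2) * ?E\<^sup>2)"
    by (simp only: inner sum.distrib sum_distrib_left sum_distrib_right mult_1 cong: sum.cong)
  also have "(\<Sum>v\<in>pverts G. \<Sum>u\<in>parcs G `` {v}. 1) = 2 * card (uedges G)"
    using G.sum_deg by (simp add: G.deg_eq_card_neighbours)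
  finally show ?thesis
    unfolding G.sum_neighbours_deg G.sum_neighbours_deg' G.zagreb2_double[symmetric]
    by (simp add: algebra_simps power2_eq_square)
qed

text \<open>Contribution of the fibre moves. At fixed \<open>v\<close> the summand depends on
  \<open>f\<close> only through \<open>f v\<close>, so one-point evaluation leaves an arc sum over
  \<open>H\<close> with all degrees shifted by \<open>deg G v\<close>.\<close>

lemma sum_fibre_arcs:
  defines "n \<equiv> card (pverts G)" and "m \<equiv> card (pverts H)"
  shows "(\<Sum>v\<in>pverts G. \<Sum>f\<in>pverts G \<rightarrow>\<^sub>E pverts H. \<Sum>y\<in>parcs H `` {f v}.
      (deg G v + deg H (f v)) * (deg G v + deg H y))
    = 2 * m ^ (n - 1) * (card (uedges H) * zagreb1 G + 2 * card (uedges G) * zagreb1 H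
        + n * zagreb2 H)"
proof -
  let ?S = "\<lambda>d. \<Sum>x\<in>pverts H. \<Sum>y\<in>parcs H `` {x}. (d + deg H x) * (d + deg H y)"
  \<comment> \<open>As a polynomial in the shift \<open>d\<close>, its coefficients are the arc
    count, twice the first and twice the second Zagreb index of \<open>H\<close>.\<close>
  have S: "?S d = d\<^sup>2 * (2 * card (uedges H)) + d * (2 * zagreb1 H) + 2 * zagreb2 H" for d
  proof -
    have "?S d = d\<^sup>2 * (\<Sum>x\<in>pverts H. \<Sum>y\<in>parcs H `` {x}. 1)
        + d * (\<Sum>x\<in>pverts H. \<Sum>y\<in>parcs H `` {x}. deg H x)
        + d * (\<Sum>x\<in>pverts H. \<Sum>y\<in>parcs H `` {x}. deg H y)
        + (\<Sum>x\<in>pverts H. \<Sum>y\<in>parcs H `` {x}. deg H x * deg H y)"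
      unfolding sum_distrib_left sum.distrib[symmetric]
      by (intro sum.cong refl) (simp add: algebra_simps power2_eq_square)
    also have "(\<Sum>x\<in>pverts H. \<Sum>y\<in>parcs H `` {x}. 1) = 2 * card (uedges H)"
      using H.sum_deg by (simp add: H.deg_eq_card_neighbours)
    finally show ?thesis
      unfolding H.sum_neighbours_deg H.sum_neighbours_deg' H.zagreb2_double[symmetric]
      by simp
  qed
  have "(\<Sum>v\<in>pverts G. \<Sum>f\<in>pverts G \<rightarrow>\<^sub>E pverts H. \<Sum>y\<in>parcs H `` {f v}.
      (deg G v + deg H (f v)) * (deg G v + deg H y))
    = (\<Sum>v\<in>pverts G. m ^ (n - 1) * ?S (deg G v))"
    unfolding n_def m_def
    by (intro sum.cong refl sum_PiE_verts[where
          g = "\<lambda>x. \<Sum>y\<in>parcs H `` {x}. (deg G _ + deg H x) * (deg G _ + deg H y)"])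
  also have "\<dots> = m ^ (n - 1) * ((\<Sum>v\<in>pverts G. (deg G v)\<^sup>2) * (2 * card (uedges H))
      + (\<Sum>v\<in>pverts G. deg G v) * (2 * zagreb1 H) + n * (2 * zagreb2 H))"
    unfolding S
    by (simp add: sum.distrib n_def flip: sum_distrib_left sum_distrib_right)
  finally show ?thesis
    by (simp add: G.sum_deg zagreb1_def[of G, symmetric] algebra_simps)
qed

text \<open>Half the sum of both contributions. The coefficient 3 is 2 from base moves plus 1 from
  fibre moves.\<close>

lemma zagreb2_wreath_product:
  defines "n \<equiv> card (pverts G)" and "m \<equiv> card (pverts H)"
  shows "zagreb2 (wreath_product G H) =
    3 * m ^ (n - 1) * card (uedges H) * zagreb1 G + 2 * card (uedges G) * m ^ (n - 1) * zagreb1 H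
    + m ^ n * zagreb2 G + n * m ^ (n - 1) * zagreb2 H
    + 4 * m ^ (n - 2) * card (uedges G) * (card (uedges H))\<^sup>2"
proof -
  let ?F = "pverts G \<rightarrow>\<^sub>E pverts H"
  let ?W = "wreath_product G H"
  have "(\<Sum>x\<in>parcs ?W `` {(f, v)}. deg ?W (f, v) * deg ?W x) =
      (\<Sum>u\<in>parcs G `` {v}. (deg G v + deg H (f v)) * (deg G u + deg H (f u)))
      + (\<Sum>y\<in>parcs H `` {f v}. (deg G v + deg H (f v)) * (deg G v + deg H y))"
    if f: "f \<in> ?F" and v: "v \<in> pverts G" for f v
  proof -
    \<comment> \<open>The degree formula is also needed at the far end of a fibre move, so the
      updated function must lie in \<open>?F\<close>.\<close>
    have "f(v := y) \<in> ?F" if "y \<in> parcs H `` {f v}" for y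
      using f v H.neighbour_in_verts[OF that] by (auto simp: PiE_iff extensional_def)
    then show ?thesis
      using f v G.neighbour_in_verts
      by (simp add: sum_neighbours_wreath_product deg_wreath_product del: Image_singleton_iff
          cong: sum.cong)
  qed
  then have "2 * zagreb2 ?W =
      (\<Sum>f\<in>?F. \<Sum>v\<in>pverts G. \<Sum>u\<in>parcs G `` {v}. (deg G v + deg H (f v)) * (deg G u + deg H (f u)))
      + (\<Sum>f\<in>?F. \<Sum>v\<in>pverts G. \<Sum>y\<in>parcs H `` {f v}. (deg G v + deg H (f v)) * (deg G v + deg H y))"
    unfolding W.zagreb2_double verts_wreath_product
    by (simp add: sum.cartesian_product' sum.distrib)
  \<comment> \<open>For base moves the arc of \<open>G\<close> is independent of \<open>f\<close>,
    so the sum over \<open>f\<close> can go innermost. For fibre moves it only passes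
    \<open>v\<close>, since the neighbourhood in \<open>H\<close> depends on
    \<open>f v\<close>.\<close>
  also have "(\<Sum>f\<in>?F. \<Sum>v\<in>pverts G. \<Sum>u\<in>parcs G `` {v}.
        (deg G v + deg H (f v)) * (deg G u + deg H (f u)))
      = (\<Sum>v\<in>pverts G. \<Sum>u\<in>parcs G `` {v}. \<Sum>f\<in>?F.
        (deg G v + deg H (f v)) * (deg G u + deg H (f u)))"
    by (subst sum.swap) (intro sum.cong refl sum.swap)
  also have "(\<Sum>f\<in>?F. \<Sum>v\<in>pverts G. \<Sum>y\<in>parcs H `` {f v}.
        (deg G v + deg H (f v)) * (deg G v + deg H y))
      = (\<Sum>v\<in>pverts G. \<Sum>f\<in>?F. \<Sum>y\<in>parcs H `` {f v}.
        (deg G v + deg H (f v)) * (deg G v + deg H y))"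
    by (rule sum.swap)
  finally show ?thesis
    unfolding sum_base_arcs sum_fibre_arcs n_def m_def by (simp add: algebra_simps)
qed

end

text \<open>The second formula is over the reals with \<open>powi\<close> because the exponent
  \<open>n - 2\<close> is negative for a one-vertex \<open>G\<close>.\<close>

theorem theorem3p1:
  fixes G :: "'a pair_pre_digraph" and H :: "'b pair_pre_digraph" and n m :: nat
  assumes "pair_graph G" and "Digraph_Component.connected (with_proj G)"
    and "pair_graph H" and "Digraph_Component.connected (with_proj H)"
    and "card (pverts G) = n" and "card (pverts H) = m"
  shows "zagreb1 (wreath_product G H) =
           m ^ (n - 1) * (m * zagreb1 G + n * zagreb1 H + 8 * card (uedges G) * card (uedges H)) \<and>
         real (zagreb2 (wreath_product G H)) =
           3 * real m ^ (n - 1) * real (card (uedges H)) * real (zagreb1 G)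
           + 2 * real (card (uedges G)) * real m ^ (n - 1) * real (zagreb1 H)
           + real m ^ n * real (zagreb2 G)
           + real n * real m ^ (n - 1) * real (zagreb2 H)
           + 4 * real m powi (int n - 2) * real (card (uedges G)) * real (card (uedges H)) ^ 2"
proof -
  interpret G: pair_graph G by fact
  interpret H: pair_graph H by fact
  interpret wreath_graphs G H by unfold_locales
  \<comment> \<open>The factor \<open>card (uedges G)\<close> is kept: without edges both sides
    vanish, and with an edge the integer and truncated exponents agree.\<close>
  have "real m powi (int n - 2) * real (card (uedges G))
      = real m ^ (n - 2) * real (card (uedges G))"
  proof (cases "uedges G = {}")
    case False
    then have "int n - 2 = int (n - 2)"
      using G.two_le_card_verts assms by simp
    then show ?thesis
      by (simp only: power_int_of_nat)
  qed simp
  then show ?thesis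
    using zagreb1_wreath_product zagreb2_wreath_product assms by (auto simp: mult.assoc)
qed

end
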